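(* For every graph $G$, there exists a polyhedral surface $\mathcal{S}$ in $\mathbb{R}^3$ (with arbitrary, not necessarily convex, polygons) whose adjacency graph $\mathcal{G}(\mathcal{S})$ is isomorphic to $G$.
   Context: Graphs are finite, simple and undirected. A polygon in $\mathbb{R}^3$ is a closed planar region (including its interior) bounded by a simple closed polygonal chain lying in some plane of $\mathbb{R}^3$; its vertices are called corners and its edges are called sides. A polyhedral surface $\mathcal{S}=\{S_1,\dots,S_n\}$ is a set of $n$ closed polygons embedded in $\mathbb{R}^3$ such that, for all pairwise distinct indices $i,j,k$: (1) $S_i$ and $S_j$ are interior-disjoint (with respect to the 2D relative interiors); (2) if $S_i\cap S_j\neq\emptyset$, then $S_i\cap S_j$ is either a single corner or a complete side of both $S_i$ and $S_j$; (3) if $S_i\cap S_j\cap S_k\neq\emptyset$, then it is a single corner (so a side is shared by at most two polygons). Sides need not be shared with another polygon. The adjacency graph $\mathcal{G}(\mathcal{S})$ has one vertex for each polygon of $\mathcal{S}$ and an edge between two vertices if and only if the corresponding polygons share a side (contacts in a single corner do not give an edge). *)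

theory Defs
  imports "HOL-Analysis.Analysis" "Graph_Theory.Graph_Theory"
begin

type_synonym point = "real ^ 3"

(* A closed polygonal chain is given by the cyclic list of its vertices. *)

definition chain_side :: "point list \<Rightarrow> nat \<Rightarrow> point set" where
  "chain_side vs i = closed_segment (vs ! i) (vs ! (Suc i mod length vs))"

definition chain_curve :: "point list \<Rightarrow> point set" where
  "chain_curve vs = (\<Union>i<length vs. chain_side vs i)"

(* Simplicity: two different sides meet at most in common endpoints.  The non-collinearity
   clause excludes straight angles, so that corners and sides are determined by the region
   and a side cannot be subdivided artificially. *)

definition simple_closed_chain :: "point list \<Rightarrow> bool" where
  "simple_closed_chain vs \<longleftrightarrow>
     3 \<le> length vs \<and> distinct vs \<and>
     (\<forall>i<length vs. \<forall>j<length vs. i \<noteq> j \<longrightarrow>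
        chain_side vs i \<inter> chain_side vs j
          = {vs ! i, vs ! (Suc i mod length vs)} \<inter> {vs ! j, vs ! (Suc j mod length vs)}) \<and>
     (\<forall>i<length vs.
        \<not> collinear {vs ! i, vs ! (Suc i mod length vs), vs ! (Suc (Suc i) mod length vs)})"

(* The region bounded by a planar chain: the chain together with the points of its plane lying in
   a bounded component of the complement, taken within that plane.  This is the constant inside
   relative to the plane; in the ambient space no point is inside. *)

definition chain_region :: "point list \<Rightarrow> point set" where
  "chain_region vs = chain_curve vs \<union>
     {x \<in> affine hull set vs - chain_curve vs.
        bounded (connected_component_set (affine hull set vs - chain_curve vs) x)}"

definition bounding_chain :: "point list \<Rightarrow> point set \<Rightarrow> bool" where
  "bounding_chain vs P \<longleftrightarrow>
     simple_closed_chain vs \<and> coplanar (set vs) \<and> P = chain_region vs"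

definition polygon :: "point set \<Rightarrow> bool" where
  "polygon P \<longleftrightarrow> (\<exists>vs. bounding_chain vs P)"

(* A bounding chain is unique up to rotation and reversal of the list, which changes neither the
   corners nor the sides. *)

definition corners :: "point set \<Rightarrow> point set" where
  "corners P = {v. \<exists>vs. bounding_chain vs P \<and> v \<in> set vs}"

definition sides :: "point set \<Rightarrow> point set set" where
  "sides P = {s. \<exists>vs i. bounding_chain vs P \<and> i < length vs \<and> s = chain_side vs i}"

definition polyhedral_surface :: "point set set \<Rightarrow> bool" where
  "polyhedral_surface \<S> \<longleftrightarrow>
     finite \<S> \<and> (\<forall>P\<in>\<S>. polygon P) \<and>
     (\<forall>P\<in>\<S>. \<forall>Q\<in>\<S>. P \<noteq> Q \<longrightarrow> rel_interior P \<inter> rel_interior Q = {}) \<and>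
     (\<forall>P\<in>\<S>. \<forall>Q\<in>\<S>. P \<noteq> Q \<longrightarrow> P \<inter> Q \<noteq> {} \<longrightarrow>
        (\<exists>v \<in> corners P \<inter> corners Q. P \<inter> Q = {v}) \<or> P \<inter> Q \<in> sides P \<inter> sides Q) \<and>
     (\<forall>P\<in>\<S>. \<forall>Q\<in>\<S>. \<forall>R\<in>\<S>. P \<noteq> Q \<longrightarrow> Q \<noteq> R \<longrightarrow> P \<noteq> R \<longrightarrow> P \<inter> Q \<inter> R \<noteq> {} \<longrightarrow>
        (\<exists>v \<in> corners P \<inter> corners Q \<inter> corners R. P \<inter> Q \<inter> R = {v}))"

(* An undirected graph is represented as a symmetric digraph; an edge {P, Q} gives both arcs. *)

definition adjacency_graph :: "point set set \<Rightarrow> point set pair_pre_digraph" where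
  "adjacency_graph \<S> =
     \<lparr> pverts = \<S>,
       parcs = {(P, Q). P \<in> \<S> \<and> Q \<in> \<S> \<and> P \<noteq> Q \<and> sides P \<inter> sides Q \<noteq> {}} \<rparr>"

end

theory Submission
  imports Defs
begin

text \<open>The polygon of the \<open>i\<close>-th vertex lies in the vertical plane over the line \<open>y = i x - i\<^sup>2\<close>, a
  tangent of the parabola \<open>4 y = x\<^sup>2\<close>. Two such planes \<open>i \<noteq> j\<close> meet in the vertical line over
  \<open>x = i + j\<close>, so no point lies in three of them. The polygon is a strip around the height \<open>5 i\<close>
  with sawteeth pointing up and down, whose vertical edges lie over integral \<open>x\<close>. For \<open>i < j\<close>, on the
  line over \<open>x = i + j\<close>, the polygon of \<open>i\<close> points up and that of \<open>j\<close> points down: if \<open>i\<close> and \<open>j\<close> are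
  adjacent, the vertical edges of both teeth fill the whole gap between the strips and
  coincide, and otherwise both teeth are short and do not touch.

  The region of a chain is bounded from outside by rays: a point from which some ray within the plane
  misses the chain lies in the unbounded component, so no form of the Jordan curve theorem is needed.\<close>

section \<open>Separating segments, and simplicity of a chain\<close>

lemma segment_face:
  fixes f :: "'a::real_vector \<Rightarrow> real"
  assumes f: "linear f" and le: "f a \<le> e" "f b \<le> e" "\<not> (f a = e \<and> f b = e)"
    and p: "p \<in> closed_segment a b" "e \<le> f p"
  shows "p \<in> {a, b}"
proof -
  obtain u where u: "0 \<le> u" "u \<le> 1" and p_eq: "p = (1 - u) *\<^sub>R a + u *\<^sub>R b"
    using p(1) by (auto simp: in_segment)
  have fp: "f p = (1 - u) * f a + u * f b"
    using f by (simp add: p_eq linear_add linear_scale)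
  show ?thesis
  proof (cases "u = 0 \<or> u = 1")
    case True
    then show ?thesis by (auto simp: p_eq)
  next
    case False
    \<comment> \<open>Strictly inside the segment both weights are positive and one end lies
      strictly below level \<open>e\<close>, so \<open>f p < e\<close>.\<close>
    then have u': "0 < u" "0 < 1 - u" using u by auto
    have 1: "(1 - u) * f a \<le> (1 - u) * e" "u * f b \<le> u * e"
      using le u' by (simp_all)
    have "(1 - u) * f a < (1 - u) * e \<or> u * f b < u * e"
      using le u' by auto
    then have "f p < (1 - u) * e + u * e" using 1 fp by linarith
    then show ?thesis using p(2) by (simp add: algebra_simps)
  qed
qed

text \<open>The hyperplane \<open>f = e\<close> separates the segments and contains neither of them.
  A common point lies on the hyperplane, and each segment can touch it only in an endpoint.\<close>

lemma segment_Int_separated: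
  fixes f :: "'a::real_vector \<Rightarrow> real"
  assumes f: "linear f" and ab: "f a \<le> e" "f b \<le> e" "\<not> (f a = e \<and> f b = e)"
    and cd: "e \<le> f c" "e \<le> f d" "\<not> (f c = e \<and> f d = e)"
  shows "closed_segment a b \<inter> closed_segment c d = {a, b} \<inter> {c, d}"
proof
  show "{a, b} \<inter> {c, d} \<subseteq> closed_segment a b \<inter> closed_segment c d" by auto
  show "closed_segment a b \<inter> closed_segment c d \<subseteq> {a, b} \<inter> {c, d}"
  proof
    fix p assume p: "p \<in> closed_segment a b \<inter> closed_segment c d"
    have conv: "f p \<in> closed_segment (f x) (f y)" if "p \<in> closed_segment x y" for x y
      using that f closed_segment_linear_image[of f x y] by blast
    have 1: "f p \<le> e" and 2: "e \<le> f p"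
      using conv[of a b] conv[of c d] p ab cd by (auto simp: closed_segment_eq_real_ivl split: if_splits)
    have f': "linear (\<lambda>x. - f x)" using f by (simp add: linear_compose_neg)
    have "p \<in> {a, b}" using segment_face[OF f ab] p 2 by blast
    moreover have "p \<in> {c, d}"
      using segment_face[OF f', of c "- e" d p] cd p 1 by auto
    ultimately show "p \<in> {a, b} \<inter> {c, d}" by blast
  qed
qed

text \<open>The chain runs from index \<open>0\<close> to \<open>M\<close> in the half space \<open>h \<ge> e\<close>, with \<open>l\<close> increasing, and
  returns in the half space \<open>h \<le> e\<close>, with \<open>l\<close> decreasing; so any two of its sides
  are separated by a level set of \<open>l\<close> or of \<open>h\<close>.\<close>

lemma simple_closed_chain_two_monotone:
  fixes v :: "nat \<Rightarrow> point" and l h :: "point \<Rightarrow> real"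
  assumes l: "linear l" and h: "linear h"
    and M: "2 \<le> M" "M + 2 \<le> N" and cyc: "v N = v 0"
    and up: "\<And>q. q < M \<Longrightarrow> l (v q) < l (v (Suc q))"
    and down: "\<And>q. M \<le> q \<Longrightarrow> q < N \<Longrightarrow> l (v (Suc q)) < l (v q)"
    and he: "h (v 0) = e" "h (v M) = e"
    and above: "\<And>q. 0 < q \<Longrightarrow> q < M \<Longrightarrow> e < h (v q)"
    and below: "\<And>q. M < q \<Longrightarrow> q < N \<Longrightarrow> h (v q) < e"
    and turn: "\<And>q. q < N \<Longrightarrow> \<not> collinear {v q, v (Suc q), v (Suc (Suc q mod N))}"
  shows "simple_closed_chain (map v [0..<N])"
proof -
  define vs where "vs = map v [0..<N]"
  have len: "length vs = N" by (simp add: vs_def)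
  have nth: "vs ! q = v q" if "q < N" for q using that by (simp add: vs_def)
  have nth_Suc: "vs ! (Suc q mod N) = v (Suc q)" if "q < N" for q
  proof (cases "Suc q = N")
    case True
    then show ?thesis using nth[of 0] cyc M by simp
  next
    case False
    then show ?thesis using nth[of "Suc q"] that by simp
  qed
  have up_mono: "l (v p) < l (v q)" if "p < q" "q \<le> M" for p q
    using that
  proof (induction q)
    case (Suc q)
    then show ?case using up[of q] by (cases "p = q") auto
  qed simp
  have down_mono: "l (v q) < l (v p)" if "M \<le> p" "p < q" "q \<le> N" for p q
    using that(2,3)
  proof (induction q)
    case (Suc q)
    then show ?case using down[of q] that(1) by (cases "p = q") auto
  qed simp
  have above': "e \<le> h (v q)" if "q \<le> M" for q
    using above[of q] he that by (cases "q = 0 \<or> q = M") (auto simp: le_less)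
  have below': "h (v q) \<le> e" if "M \<le> q" "q \<le> N" for q
    using below[of q] he cyc that by (cases "q = M \<or> q = N") (auto simp: le_less)
  have l': "linear (\<lambda>x. - l x)" using l by (simp add: linear_compose_neg)
  have h': "linear (\<lambda>x. - h x)" using h by (simp add: linear_compose_neg)
  have Int: "closed_segment (v i) (v (Suc i)) \<inter> closed_segment (v j) (v (Suc j))
      = {v i, v (Suc i)} \<inter> {v j, v (Suc j)}" if ij: "i < j" "j < N" for i j
  proof -
    consider "j < M" | "i < M" "M \<le> j" | "M \<le> i" by linarith
    then show ?thesis
    proof cases
      case 1
      have "l (v (Suc i)) \<le> l (v j)" using up_mono[of "Suc i" j] ij 1 by (cases "Suc i = j") auto
      then show ?thesis
        using up[of i] up[of j] ij 1 by (intro segment_Int_separated[OF l, of _ "l (v (Suc i))"]) auto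
    next
      case 2
      \<comment> \<open>Level \<open>e\<close> is reached by \<open>h\<close> only at the vertices
        \<open>0\<close> and \<open>M\<close>; as \<open>2 \<le> M\<close> and
        \<open>M + 2 \<le> N\<close>, no side joins these two, so no side lies in the separating
        plane.\<close>
      have "\<not> (h (v i) = e \<and> h (v (Suc i)) = e)"
        using above[of i] above[of "Suc i"] M 2 by (cases "i = 0") auto
      moreover have "\<not> (h (v j) = e \<and> h (v (Suc j)) = e)"
        using below[of j] below[of "Suc j"] M 2 ij by (cases "j = M") auto
      ultimately show ?thesis
        using above'[of i] above'[of "Suc i"] below'[of j] below'[of "Suc j"] 2 ij
        by (intro segment_Int_separated[OF h', of _ "- e"]) auto
    next
      case 3
      have "l (v j) \<le> l (v (Suc i))" using down_mono[of "Suc i" j] ij 3 by (cases "Suc i = j") auto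
      then show ?thesis
        using down[of i] down[of j] ij 3
        by (intro segment_Int_separated[OF l', of _ "- l (v (Suc i))"]) auto
    qed
  qed
  have "v i \<noteq> v j" if "i < j" "j < N" for i j
  proof -
    consider "j \<le> M" | "i < M" "M < j" | "M \<le> i" by linarith
    then show ?thesis
    proof cases
      case 1 then show ?thesis using up_mono[of i j] that by auto
    next
      case 2 then show ?thesis using above'[of i] below[of j] that by auto
    next
      case 3 then show ?thesis using down_mono[of i j] that by auto
    qed
  qed
  then have "inj_on v {0..<N}" by (auto simp: inj_on_def) (metis linorder_neq_iff)
  then have dist: "distinct vs" by (simp add: vs_def distinct_map)
  have side: "chain_side vs i = closed_segment (v i) (v (Suc i))" if "i < N" for i
    using nth[OF that] nth_Suc[OF that] by (simp add: chain_side_def len)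
  have Int': "chain_side vs i \<inter> chain_side vs j
      = {vs ! i, vs ! (Suc i mod length vs)} \<inter> {vs ! j, vs ! (Suc j mod length vs)}"
    if "i < length vs" "j < length vs" "i \<noteq> j" for i j
  proof -
    have ij: "i < N" "j < N" using that len by auto
    have "closed_segment (v i) (v (Suc i)) \<inter> closed_segment (v j) (v (Suc j))
        = {v i, v (Suc i)} \<inter> {v j, v (Suc j)}"
      using Int[of i j] Int[of j i] ij \<open>i \<noteq> j\<close> by (metis Int_commute linorder_neqE_nat)
    then show ?thesis
      unfolding len side[OF ij(1)] side[OF ij(2)] nth[OF ij(1)] nth[OF ij(2)]
        nth_Suc[OF ij(1)] nth_Suc[OF ij(2)] .
  qed
  have turn': "\<not> collinear {vs ! q, vs ! (Suc q mod N), vs ! (Suc (Suc q) mod N)}" if "q < N" for q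
  proof -
    \<comment> \<open>The hypothesis \<open>turn\<close> wraps before the last successor, so the
      third vertex may carry the index \<open>N\<close>; by \<open>cyc\<close> this is the same
      point as after wrapping twice.\<close>
    have "Suc (Suc q) mod N = Suc (Suc q mod N) mod N" by (simp add: mod_Suc_eq)
    then have "vs ! (Suc (Suc q) mod N) = v (Suc (Suc q mod N))"
      using nth_Suc[of "Suc q mod N"] M by simp
    then show ?thesis unfolding nth[OF that] nth_Suc[OF that] using turn[OF that] by (simp only: not_False_eq_True)
  qed
  show ?thesis
    using Int' dist turn' M unfolding simple_closed_chain_def vs_def[symmetric] by (simp add: len)
qed

section \<open>Rays escaping from a region\<close>

lemma chain_region_ray:
  assumes p: "p \<in> chain_region vs" and d: "d \<noteq> 0"
    and ray: "\<And>t. 0 \<le> t \<Longrightarrow> p + t *\<^sub>R d \<in> affine hull set vs"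
  shows "\<exists>t\<ge>0. p + t *\<^sub>R d \<in> chain_curve vs"
proof (rule ccontr)
  assume "\<not> ?thesis"
  then have no: "p + t *\<^sub>R d \<notin> chain_curve vs" if "0 \<le> t" for t using that by auto
  define R where "R = (\<lambda>t. p + t *\<^sub>R d) ` {0..}"
  let ?A = "affine hull set vs - chain_curve vs"
  have pR: "p \<in> R" unfolding R_def by (rule image_eqI[of _ _ 0]) auto
  have RA: "R \<subseteq> ?A" using no ray by (auto simp: R_def)
  have "convex R" unfolding R_def
    by (intro convex_translation[of "(\<lambda>t. t *\<^sub>R d) ` {0..}" p, unfolded image_image]
        convex_linear_image linearI) (auto simp: algebra_simps)
  then have "R \<subseteq> connected_component_set ?A p"
    by (intro connected_component_maximal convex_connected pR RA)
  moreover have "p \<notin> chain_curve vs" using no[of 0] by simp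
  then have "bounded (connected_component_set ?A p)"
    using p by (simp add: chain_region_def)
  ultimately have "bounded R" by (rule bounded_subset[rotated])
  then obtain B where B: "\<And>x. x \<in> R \<Longrightarrow> norm x \<le> B" by (auto simp: bounded_iff)
  \<comment> \<open>Chosen so that \<open>t *\<^sub>R d\<close> has norm
    \<open>\<bar>B\<bar> + norm p + 1\<close>, which carries \<open>p\<close> out of the ball of
    radius \<open>B\<close>.\<close>
  define t where "t = (\<bar>B\<bar> + norm p + 1) / norm d"
  have t: "0 \<le> t" by (simp add: t_def)
  then have "p + t *\<^sub>R d \<in> R" by (auto simp: R_def)
  then have "norm (p + t *\<^sub>R d) \<le> B" by (rule B)
  moreover have "norm (t *\<^sub>R d) = \<bar>B\<bar> + norm p + 1" using d t by (simp add: t_def)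
  ultimately show False using norm_triangle_ineq4[of "p + t *\<^sub>R d" p] by simp
qed

section \<open>The sawtooth polygon\<close>

lemma collinear_imp_det:
  fixes f g :: "'a::real_vector \<Rightarrow> real"
  assumes "linear f" "linear g" "collinear {a, b, c}"
  shows "(f b - f a) * (g c - g a) = (f c - f a) * (g b - g a)"
proof -
  \<comment> \<open>Both differences from \<open>a\<close> are multiples of one vector
    \<open>u\<close>, so the two columns of the minor are proportional.\<close>
  obtain u where u: "\<And>x y. x \<in> {a, b, c} \<Longrightarrow> y \<in> {a, b, c} \<Longrightarrow> \<exists>k. x - y = k *\<^sub>R u"
    using assms(3) unfolding collinear_def by blast
  obtain k1 k2 where k: "b - a = k1 *\<^sub>R u" "c - a = k2 *\<^sub>R u"
    using u[of b a] u[of c a] by auto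
  have "f b - f a = k1 * f u" "f c - f a = k2 * f u" "g b - g a = k1 * g u" "g c - g a = k2 * g u"
    using k assms by (metis linear_diff linear_scale real_scaleR_def)+
  then show ?thesis by simp
qed

text \<open>The polygon lies in the plane \<open>y = a x + b\<close>. Its strip has heights from
  \<open>c - 1\<close> to \<open>c + 1\<close> and runs from \<open>x = 0\<close> to
  \<open>x = m\<close>; \<open>hi k\<close> and \<open>lo k\<close> are the heights of the tooth
  tips over \<open>x = k\<close>, and \<open>D\<close> bounds their distance from
  \<open>c\<close>.\<close>

locale sawtooth =
  fixes a b c D :: real and m :: nat and hi lo :: "nat \<Rightarrow> real"
  assumes m: "2 \<le> m"
    and hi: "c + 1 < hi k" "hi k \<le> c + D"
    and lo: "lo k < c - 1" "c - D \<le> lo k"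
begin

definition pt :: "real \<Rightarrow> real \<Rightarrow> point" where
  "pt x z = vector [x, a * x + b, z]"

definition plane :: "point set" where
  "plane = {p. p $ 2 = a * p $ 1 + b}"

text \<open>The vertices \<open>0, \<dots>, 2 m\<close> form the upper boundary from left to right, the vertices
  \<open>2 m, \<dots>, 4 m\<close> the lower boundary from right to left; index \<open>4 m\<close> is vertex \<open>0\<close> again.\<close>

definition X :: "nat \<Rightarrow> nat" where
  "X q = (if q \<le> 2 * m then (q + 1) div 2 else (4 * m - q) div 2)"

text \<open>At both ends of the strip the vertical edge runs from a tip straight to the opposite
  border: vertex \<open>2 * m\<close> has height \<open>c - 1\<close> and vertex
  \<open>4 * m\<close> has height \<open>c + 1\<close>. A further vertex on these edges would create
  a straight angle.\<close>

definition Z :: "nat \<Rightarrow> real" where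
  "Z q = (if q < 2 * m then if odd q then hi (X q) else c + 1
          else if q < 4 * m then if odd q then lo (X q) else c - 1
          else c + 1)"

definition vert :: "nat \<Rightarrow> point" where
  "vert q = pt (real (X q)) (Z q)"

definition chain :: "point list" where
  "chain = map vert [0..<4 * m]"

definition region :: "point set" where
  "region = chain_region chain"

lemma pt_nth [simp]: "pt x z $ 1 = x" "pt x z $ 2 = a * x + b" "pt x z $ 3 = z"
  by (simp_all add: pt_def)

lemma pt_eq_iff [simp]: "pt x z = pt x' z' \<longleftrightarrow> x = x' \<and> z = z'"
  by (metis pt_nth(1,3))

lemma one_less_D: "1 < D"
  using hi[of 0] by linarith

lemma linear_coord: "linear (\<lambda>p::point. s * p $ k + t * p $ l)"
  by (rule linearI) (auto simp: algebra_simps)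

lemma linear_coord1: "linear (\<lambda>p::point. p $ k)"
  by (rule linearI) auto

lemma Z_bounds: "lo (X q) \<le> Z q" "Z q \<le> hi (X q)"
  using hi[of "X q"] lo[of "X q"] unfolding Z_def by auto

text \<open>Edges with even index are slanted and one unit wide, those with odd index are vertical.
  The inequalities in \<open>drop\<close> and \<open>climb\<close> cover the two longer edges at the
  ends of the strip.\<close>

lemma vert_cases:
  assumes "q < 4 * m"
  obtains (rise) "q < 2 * m" "even q" "X (Suc q) = Suc (X q)" "Z q = c + 1" "Z (Suc q) = hi (X (Suc q))"
  | (drop) "q < 2 * m" "odd q" "X (Suc q) = X q" "Z q = hi (X q)" "Z (Suc q) \<le> c + 1"
  | (dive) "2 * m \<le> q" "even q" "X q = Suc (X (Suc q))" "Z q = c - 1" "Z (Suc q) = lo (X (Suc q))"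
  | (climb) "2 * m \<le> q" "odd q" "X (Suc q) = X q" "Z q = lo (X q)" "c - 1 \<le> Z (Suc q)"
proof (cases "q < 2 * m")
  case True
  show ?thesis
  proof (cases "even q")
    case True
    with \<open>q < 2 * m\<close> have "Suc q < 2 * m" by presburger
    moreover have "Suc (Suc q) div 2 = Suc (Suc q div 2)" using True by presburger
    ultimately show ?thesis using True \<open>q < 2 * m\<close> by (intro rise) (auto simp: X_def Z_def)
  next
    case False
    then have "X (Suc q) = X q" using True unfolding X_def by (auto elim!: oddE)
    then show ?thesis using False True by (intro drop) (auto simp: Z_def)
  qed
next
  case False
  then have q: "2 * m \<le> q" by simp
  show ?thesis
  proof (cases "even q")
    case True
    with assms have "Suc q < 4 * m" by presburger
    moreover have "X q = (4 * m - q) div 2" using q by (auto simp: X_def)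
    moreover have "(4 * m - q) div 2 = Suc ((4 * m - Suc q) div 2)" using True assms by presburger
    ultimately show ?thesis using True q assms by (intro dive) (auto simp: X_def Z_def)
  next
    case False
    have "(4 * m - Suc q) div 2 = (4 * m - q) div 2" using False assms by presburger
    then have "X (Suc q) = X q" using q False by (auto simp: X_def)
    then show ?thesis using False q assms by (intro climb) (auto simp: Z_def)
  qed
qed

lemma vert_wrap: "vert (4 * m) = vert 0"
  using m by (simp add: vert_def X_def Z_def)

lemma vert_ends: "vert 0 $ 1 = 0" "vert (2 * m) $ 1 = real m"
  by (simp_all add: vert_def X_def)

lemma length_chain [simp]: "length chain = 4 * m"
  by (simp add: chain_def)

lemma chain_side_eq: "q < 4 * m \<Longrightarrow> chain_side chain q = closed_segment (vert q) (vert (Suc q))"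
  using m vert_wrap by (cases "Suc q = 4 * m") (auto simp: chain_side_def chain_def)

text \<open>Slanted and vertical edges alternate, also across the wrap because \<open>4 * m\<close>
  is even. A slanted edge next to a vertical one of nonzero length has nonzero determinant.\<close>

lemma turn:
  assumes q: "q < 4 * m"
  shows "\<not> collinear {vert q, vert (Suc q), vert (Suc (Suc q mod (4 * m)))}"
proof
  let ?r = "Suc q mod (4 * m)"
  assume "collinear {vert q, vert (Suc q), vert (Suc ?r)}"
  moreover have vr: "vert (Suc q) = vert ?r"
    using q vert_wrap by (cases "Suc q = 4 * m") auto
  ultimately have col: "collinear {vert q, vert ?r, vert (Suc ?r)}" by simp
  have det: "(real (X ?r) - X q) * (Z (Suc ?r) - Z q) = (real (X (Suc ?r)) - X q) * (Z ?r - Z q)"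
    using collinear_imp_det[OF linear_coord1 linear_coord1 col, of 1 3] by (simp add: vert_def)
  have r: "?r < 4 * m" using m by simp
  have par: "even ?r \<longleftrightarrow> odd q"
    using q by (cases "Suc q = 4 * m") (auto, presburger)
  have XZ: "X (Suc q) = X ?r" "Z (Suc q) = Z ?r" using vr by (simp_all add: vert_def)
  have ne: "Z ?r \<noteq> Z (Suc ?r)" if "odd ?r"
    using r by (cases rule: vert_cases)
      (use that hi[of "X ?r"] lo[of "X ?r"] in \<open>auto\<close>)
  have ne': "Z q \<noteq> Z (Suc q)" if "odd q"
    using q by (cases rule: vert_cases)
      (use that hi[of "X q"] lo[of "X q"] in \<open>auto\<close>)
  have X_even: "X p \<noteq> X (Suc p)" if "even p" "p < 4 * m" for p
    using that(2) by (cases rule: vert_cases) (use that in auto)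
  have X_odd: "X p = X (Suc p)" if "odd p" "p < 4 * m" for p
    using that(2) by (cases rule: vert_cases) (use that in auto)
  show False
  proof (cases "even q")
    case True
    then have "odd ?r" using par by simp
    then show False using det ne X_even[OF True q] X_odd[OF _ r] XZ by auto
  next
    case False
    then have "even ?r" using par by simp
    then show False using det ne'[OF False] X_even[OF _ r] X_odd[OF False q] XZ by auto
  qed
qed

lemma simple_chain: "simple_closed_chain chain"
  unfolding chain_def
proof (rule simple_closed_chain_two_monotone)
  \<comment> \<open>The shear by \<open>1 / (2 D)\<close> is too small to reverse the slanted edges, but makes the vertical
    edges monotone as well.\<close>
  let ?l = "\<lambda>p::point. 1 * p $ 1 + (- 1 / (2 * D)) * p $ 3"
  \<comment> \<open>With slope \<open>2 / m\<close>, the level \<open>c + 1\<close> is the diagonal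
    of the strip from vertex \<open>0\<close> to vertex \<open>2 * m\<close>; it separates the upper
    boundary from the lower one.\<close>
  let ?h = "\<lambda>p::point. (2 / m) * p $ 1 + 1 * p $ 3"
  show "linear ?l" "linear ?h" by (rule linear_coord)+
  show "2 \<le> 2 * m" "2 * m + 2 \<le> 4 * m" "vert (4 * m) = vert 0"
    using m vert_wrap by auto
  show "?h (vert 0) = c + 1" "?h (vert (2 * m)) = c + 1"
    using m by (simp_all add: vert_def X_def Z_def)
  \<comment> \<open>A slanted edge changes height by at most \<open>D - 1\<close>, so the shear
    costs less than the unit gained in \<open>x\<close>.\<close>
  have shear: "(z - z') / (2 * D) < 1" if "z - z' < 2 * D" for z z'
    using that one_less_D by (simp add: divide_simps)
  show "?l (vert q) < ?l (vert (Suc q))" if "q < 2 * m" for q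
  proof -
    from that have "q < 4 * m" by simp
    then show ?thesis
    proof (cases rule: vert_cases)
      case rise
      then show ?thesis using shear[of "Z (Suc q)" "Z q"] hi[of "X (Suc q)"] one_less_D
        by (auto simp: vert_def diff_divide_distrib)
    next
      case drop
      then have "Z (Suc q) / (2 * D) < Z q / (2 * D)" using hi[of "X q"] one_less_D
        by (intro divide_strict_right_mono) auto
      then show ?thesis using drop by (auto simp: vert_def)
    qed (use that in auto)
  qed
  show "?l (vert (Suc q)) < ?l (vert q)" if "2 * m \<le> q" "q < 4 * m" for q
    using that(2)
  proof (cases rule: vert_cases)
    case dive
    then show ?thesis using shear[of "Z q" "Z (Suc q)"] lo[of "X (Suc q)"] one_less_D
      by (auto simp: vert_def diff_divide_distrib)
  next
    case climb
    then have "Z q / (2 * D) < Z (Suc q) / (2 * D)" using lo[of "X q"] one_less_D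
      by (intro divide_strict_right_mono) auto
    then show ?thesis using climb by (auto simp: vert_def)
  qed (use that in auto)
  show "c + 1 < ?h (vert q)" if "0 < q" "q < 2 * m" for q
  proof -
    have "0 < X q" using that by (auto simp: X_def)
    then have "0 < 2 / m * X q" using m by simp
    moreover have "c + 1 \<le> Z q" using that hi[of "X q"] by (auto simp: Z_def)
    ultimately show ?thesis by (simp add: vert_def)
  qed
  show "?h (vert q) < c + 1" if "2 * m < q" "q < 4 * m" for q
  proof -
    have "X q < m" using that by (auto simp: X_def)
    then have "2 / m * X q < 2" using m by (simp add: divide_simps)
    moreover have "Z q \<le> c - 1" using that lo[of "X q"] by (auto simp: Z_def)
    ultimately show ?thesis by (simp add: vert_def)
  qed
qed (rule turn)

lemma affine_plane: "affine plane"
  unfolding affine_def plane_def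
proof clarsimp
  fix x y :: point and u v :: real
  assume uv: "u + v = 1"
  have "b = (u + v) * b" using uv by simp
  then show "u * (a * x $ 1 + b) + v * (a * y $ 1 + b) = a * (u * x $ 1 + v * y $ 1) + b"
    by (simp add: algebra_simps)
qed

lemma vert_in_plane: "vert q \<in> plane"
  by (simp add: vert_def plane_def)

text \<open>Three non-collinear corners already span the plane. A general \<open>S\<close> lets this
  serve the chain, the three points witnessing coplanarity, and the region.\<close>

lemma affine_hull_eq_plane:
  assumes "S \<subseteq> plane" "vert 0 \<in> S" "vert (2 * m) \<in> S" "vert (4 * m - 1) \<in> S"
  shows "affine hull S = plane"
proof
  show "affine hull S \<subseteq> plane" using assms(1) affine_plane by (rule hull_minimal)
  show "plane \<subseteq> affine hull S"
  proof
    fix p assume p: "p \<in> plane"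
    have v: "vert 0 = pt 0 (c + 1)" "vert (2 * m) = pt m (c - 1)" "vert (4 * m - 1) = pt 0 (lo 0)"
      using m by (auto simp: vert_def X_def Z_def)
    have in_hull: "pt 0 (c + 1) \<in> affine hull S" "pt m (c - 1) \<in> affine hull S" "pt 0 (lo 0) \<in> affine hull S"
      using assms(2-4)[unfolded v, THEN hull_inc] by auto
    \<comment> \<open>\<open>s\<close> is solved from the first coordinate and \<open>t\<close> from
      the third; the second then follows from the equation of the plane.\<close>
    define s where "s = p $ 1 / m"
    define t where "t = (p $ 3 - (c + 1) - s * (c - 1 - lo 0)) / (c + 1 - lo 0)"
    have "c + 1 - lo 0 \<noteq> 0" using lo[of 0] by simp
    then have t: "t * (c + 1 - lo 0) = p $ 3 - (c + 1) - s * (c - 1 - lo 0)" by (simp add: t_def)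
    have s: "s * m = p $ 1" using m by (simp add: s_def)
    have "p = (pt 0 (c + 1) + s *\<^sub>R (pt m (c - 1) - pt 0 (lo 0))) + t *\<^sub>R (pt 0 (c + 1) - pt 0 (lo 0))"
      using p s t by (auto simp: vec_eq_iff forall_3 plane_def algebra_simps)
    moreover have "\<dots> \<in> affine hull S"
      by (intro mem_affine_3_minus affine_affine_hull in_hull)
    ultimately show "p \<in> affine hull S" by simp
  qed
qed

lemma set_chain: "set chain = vert ` {..<4 * m}"
  by (auto simp: chain_def)

lemma affine_hull_chain: "affine hull set chain = plane"
  using m by (intro affine_hull_eq_plane) (auto simp: set_chain vert_in_plane)

lemma bounding_chain_region: "bounding_chain chain region"
proof -
  have "affine hull {vert 0, vert (2 * m), vert (4 * m - 1)} = plane"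
    by (rule affine_hull_eq_plane) (auto simp: vert_in_plane)
  moreover have "set chain \<subseteq> plane"
    using vert_in_plane by (auto simp: set_chain)
  ultimately have "coplanar (set chain)"
    unfolding coplanar_def by metis
  then show ?thesis using simple_chain by (simp add: bounding_chain_def region_def)
qed

lemma polygon_region: "polygon region"
  using bounding_chain_region by (auto simp: polygon_def)

lemma chain_curve_eq: "chain_curve chain = (\<Union>q<4 * m. closed_segment (vert q) (vert (Suc q)))"
  by (simp add: chain_curve_def chain_side_eq)

lemma chain_curve_subset_region: "chain_curve chain \<subseteq> region"
  by (simp add: region_def chain_region_def)

lemma vert_in_region: "q < 4 * m \<Longrightarrow> vert q \<in> region"
  using chain_curve_subset_region by (auto simp: chain_curve_eq)

lemma region_subset_plane: "region \<subseteq> plane"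
proof -
  have "closed_segment (vert q) (vert r) \<subseteq> plane" for q r
    by (intro closed_segment_subset affine_imp_convex affine_plane vert_in_plane)
  then have "chain_curve chain \<subseteq> plane" by (auto simp: chain_curve_eq)
  then show ?thesis by (auto simp: region_def chain_region_def affine_hull_chain)
qed

lemma affine_hull_region: "affine hull region = plane"
  using m by (intro affine_hull_eq_plane region_subset_plane vert_in_region) auto

lemma chain_curveE:
  assumes "p \<in> chain_curve chain"
  obtains q and u :: real where "q < 4 * m" "0 \<le> u" "u \<le> 1"
    "p $ 1 = (1 - u) * X q + u * X (Suc q)" "p $ 3 = (1 - u) * Z q + u * Z (Suc q)"
  using assms that by (auto simp: chain_curve_eq in_segment vert_def)

text \<open>Slanted edges span exactly one unit between integers, so over \<open>x = k\<close> they
  contribute only endpoints; a vertical edge over \<open>k\<close> lies between its ends. Hence the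
  bounds at vertices suffice.\<close>

lemma chain_curve_bounds:
  assumes p: "p \<in> chain_curve chain" "p $ 1 = real k"
  shows "lo k \<le> p $ 3" "p $ 3 \<le> hi k"
proof -
  obtain q and u :: real where q: "q < 4 * m" and u: "0 \<le> u" "u \<le> 1"
    and p1: "p $ 1 = (1 - u) * X q + u * X (Suc q)" and p3: "p $ 3 = (1 - u) * Z q + u * Z (Suc q)"
    using p(1) by (rule chain_curveE)
  have "lo k \<le> p $ 3 \<and> p $ 3 \<le> hi k"
  proof (cases "X (Suc q) = X q")
    case True
    then have k: "X q = k" using p(2) p1 by (simp add: algebra_simps)
    have "p $ 3 \<in> closed_segment (Z q) (Z (Suc q))"
      unfolding in_segment using u p3 by auto
    then show ?thesis
      using Z_bounds[of q] Z_bounds[of "Suc q"] True k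
      by (auto simp: closed_segment_eq_real_ivl split: if_splits)
  next
    case False
    with q have "X (Suc q) = Suc (X q) \<or> X q = Suc (X (Suc q))" by (cases rule: vert_cases) auto
    then show ?thesis
    proof
      assume X: "X (Suc q) = Suc (X q)"
      then have "real k = X q + u" using p(2) p1 by (simp add: algebra_simps)
      then have "k = X q \<or> k = X (Suc q)" "u = real k - X q" using u X by auto
      then show ?thesis
        using Z_bounds[of q] Z_bounds[of "Suc q"] p3 X by auto
    next
      assume X: "X q = Suc (X (Suc q))"
      then have "real k = X q - u" using p(2) p1 by (simp add: algebra_simps)
      then have "k = X q \<or> k = X (Suc q)" "u = X q - real k" using u X by auto
      then show ?thesis
        using Z_bounds[of q] Z_bounds[of "Suc q"] p3 X by auto
    qed
  qed
  then show "lo k \<le> p $ 3" "p $ 3 \<le> hi k" by auto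
qed

text \<open>Between two integers there are no vertical edges, and the only edge above the strip is
  the one rising to the tip over \<open>k + 1\<close>. The bound tends to \<open>c + 1\<close> as
  \<open>s\<close> tends to \<open>0\<close>.\<close>

lemma chain_curve_right_of_tooth:
  assumes p: "p \<in> chain_curve chain" and s: "p $ 1 = real k + s" "0 < s" "s < 1"
  shows "p $ 3 \<le> c + 1 + s * (hi (Suc k) - (c + 1))"
proof -
  obtain q and u :: real where q: "q < 4 * m" and u: "0 \<le> u" "u \<le> 1"
    and p1: "p $ 1 = (1 - u) * X q + u * X (Suc q)" and p3: "p $ 3 = (1 - u) * Z q + u * Z (Suc q)"
    using p by (rule chain_curveE)
  have not_nat: False if "real k + s = real x" for x
  proof -
    have "real k < real x" "real x < real (Suc k)" using that s(2,3) by auto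
    then show False unfolding of_nat_less_iff by simp
  qed
  from q show ?thesis
  proof (cases rule: vert_cases)
    case rise
    then have "real k + s = X q + u" using p1 s by (simp add: algebra_simps)
    moreover from this have "k = X q" using s u by linarith
    ultimately show ?thesis using p3 rise by (simp add: algebra_simps)
  next
    case dive
    have "p $ 3 \<in> closed_segment (Z q) (Z (Suc q))"
      unfolding in_segment using u p3 by auto
    then have "p $ 3 \<le> c - 1"
      using dive lo[of "X (Suc q)"] by (auto simp: closed_segment_eq_real_ivl split: if_splits)
    moreover have "0 \<le> s * (hi (Suc k) - (c + 1))" using s hi(1)[of "Suc k"] by simp
    ultimately show ?thesis by simp
  qed (use p1 s not_nat in \<open>auto simp: algebra_simps\<close>)
qed

text \<open>The vertical direction stays in the plane. Taking \<open>r\<close> positive or negative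
  gives a curve point above or below \<open>p\<close>, which transfers height bounds from the curve
  to the region.\<close>

lemma region_vertical:
  assumes p: "p \<in> region" and r: "r \<noteq> 0"
  shows "\<exists>t\<ge>0. \<exists>q\<in>chain_curve chain. q $ 1 = p $ 1 \<and> q $ 3 = p $ 3 + t * r"
proof -
  have "p \<in> plane" using p region_subset_plane by blast
  then have "p + t *\<^sub>R (vector [0, 0, r] :: point) \<in> affine hull set chain" for t
    by (simp add: affine_hull_chain plane_def)
  moreover have "(vector [0, 0, r] :: point) \<noteq> 0"
    using r by (simp add: vec_eq_iff forall_3)
  ultimately obtain t where "0 \<le> t" "p + t *\<^sub>R (vector [0, 0, r] :: point) \<in> chain_curve chain"
    using chain_region_ray[of p chain] p unfolding region_def by blast
  then show ?thesis by (intro exI[of _ t] conjI bexI) auto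
qed

lemma region_bounds:
  assumes "p \<in> region" "p $ 1 = real k"
  shows "lo k \<le> p $ 3" "p $ 3 \<le> hi k"
  using region_vertical[OF assms(1), of 1] region_vertical[OF assms(1), of "-1"]
    chain_curve_bounds[of _ k] assms(2) by force+

lemma region_right_of_tooth:
  assumes "p \<in> region" "p $ 1 = real k + s" "0 < s" "s < 1"
  shows "p $ 3 \<le> c + 1 + s * (hi (Suc k) - (c + 1))"
  using region_vertical[OF assms(1), of 1] chain_curve_right_of_tooth[of _ k s] assms(2-4) by force

lemma rel_interior_region_step:
  assumes p: "p \<in> rel_interior region" and w: "w $ 2 = a * w $ 1"
  obtains e where "0 < e" "\<And>s. 0 \<le> s \<Longrightarrow> s \<le> e \<Longrightarrow> p + s *\<^sub>R w \<in> region"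
proof -
  obtain e where e: "0 < e" "ball p e \<inter> plane \<subseteq> region" and pr: "p \<in> region"
    using p by (auto simp: mem_rel_interior_ball affine_hull_region)
  have pp: "p \<in> plane" using pr region_subset_plane by blast
  show thesis
  proof
    \<comment> \<open>Adding \<open>1\<close> avoids division by zero and keeps
      \<open>s * norm w\<close> strictly below \<open>e\<close>.\<close>
    show "0 < e / (norm w + 1)" using e by (simp add: add_nonneg_pos)
    fix s assume s: "0 \<le> s" "s \<le> e / (norm w + 1)"
    then have "s * (norm w + 1) \<le> e" by (simp add: pos_le_divide_eq add_nonneg_pos)
    then have "s * norm w < e" using s(1) e(1) by (cases "s = 0") (auto simp: algebra_simps)
    then have "p + s *\<^sub>R w \<in> ball p e" using s by (simp add: dist_norm)
    moreover have "p + s *\<^sub>R w \<in> plane" using pp w by (simp add: plane_def algebra_simps)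
    ultimately show "p + s *\<^sub>R w \<in> region" using e by blast
  qed
qed

text \<open>From a point at height \<open>lo k\<close>, any small step downwards would leave the
  region.\<close>

lemma rel_interior_lower_bound:
  assumes p: "p \<in> rel_interior region" "p $ 1 = real k"
  shows "lo k < p $ 3"
proof -
  let ?w = "vector [0, 0, -1] :: point"
  obtain e where e: "0 < e" "\<And>s. 0 \<le> s \<Longrightarrow> s \<le> e \<Longrightarrow> p + s *\<^sub>R ?w \<in> region"
    using rel_interior_region_step[OF p(1), of ?w] by auto
  have "lo k \<le> (p + e *\<^sub>R ?w) $ 3" by (rule region_bounds) (use e p(2) in auto)
  then show ?thesis using e(1) by simp
qed

text \<open>The edges of the teeth drop vertically on the right, hence the region has no points just to the
  right of an upper tooth.\<close>

lemma rel_interior_upper_bound: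
  assumes p: "p \<in> rel_interior region" "p $ 1 = real k"
  shows "p $ 3 \<le> c + 1"
proof (rule ccontr)
  assume "\<not> ?thesis"
  then have gt: "0 < p $ 3 - (c + 1)" by simp
  let ?w = "vector [1, a, 0] :: point"
  obtain e where e: "0 < e" "\<And>s. 0 \<le> s \<Longrightarrow> s \<le> e \<Longrightarrow> p + s *\<^sub>R ?w \<in> region"
    using rel_interior_region_step[OF p(1), of ?w] by auto
  define h where "h = hi (Suc k) - (c + 1)"
  have h: "0 < h" using hi(1)[of "Suc k"] by (simp add: h_def)
  \<comment> \<open>Small enough to stay in the region, to end before the next tooth, and to keep
    the rising edge below half of the excess of \<open>p\<close> over \<open>c + 1\<close>.\<close>
  define s where "s = min e (min (1 / 2) ((p $ 3 - (c + 1)) / (2 * h)))"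
  have s: "0 < s" "s \<le> e" "s < 1" "s \<le> (p $ 3 - (c + 1)) / (2 * h)"
    using e(1) gt h by (auto simp: s_def)
  have "(p + s *\<^sub>R ?w) $ 3 \<le> c + 1 + s * (hi (Suc k) - (c + 1))"
    by (rule region_right_of_tooth) (use e(2) s p(2) in auto)
  then have "p $ 3 - (c + 1) \<le> s * h" by (simp add: h_def)
  moreover have "s * h \<le> (p $ 3 - (c + 1)) / 2" using s(4) h by (simp add: field_simps)
  ultimately show False using gt by simp
qed

lemma chain_side_in_sides: "q < 4 * m \<Longrightarrow> closed_segment (vert q) (vert (Suc q)) \<in> sides region"
  using bounding_chain_region chain_side_eq[of q] unfolding sides_def by force

lemma upper_tooth_side:
  assumes "0 < k" "k < m"
  shows "closed_segment (pt k (c + 1)) (pt k (hi k)) \<in> sides region"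
proof -
  \<comment> \<open>The tip over \<open>k\<close> has index \<open>2 * k - 1\<close> and is followed
    by its base; \<open>k < m\<close> excludes the long edge at the right end.\<close>
  have "vert (2 * k - 1) = pt k (hi k)" "vert (Suc (2 * k - 1)) = pt k (c + 1)"
    using assms by (auto simp: vert_def X_def Z_def)
  then show ?thesis
    using chain_side_in_sides[of "2 * k - 1"] assms by (simp add: closed_segment_commute)
qed

lemma lower_tooth_side:
  assumes "0 < k" "k < m"
  shows "closed_segment (pt k (lo k)) (pt k (c - 1)) \<in> sides region"
proof -
  \<comment> \<open>The odd index with \<open>(4 * m - ?q) div 2 = k\<close>; its successor is the
    base of the tooth, as \<open>0 < k\<close> excludes the closing edge.\<close>
  let ?q = "4 * m - 2 * k - 1"
  have q: "2 * m < ?q" "odd ?q" "?q < 4 * m" "Suc ?q = 4 * m - 2 * k" "4 * m - ?q = 2 * k + 1"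
    using assms by simp_all
  have "X ?q = k" using q(1) unfolding X_def q(5) by auto
  moreover have "X (Suc ?q) = k" using q(1) assms unfolding q(4) by (auto simp: X_def)
  moreover have "Z ?q = lo (X ?q)" using q(1-3) by (auto simp: Z_def)
  moreover have "Z (Suc ?q) = c - 1" using assms unfolding q(4) by (auto simp: Z_def)
  ultimately have "vert ?q = pt k (lo k)" "vert (Suc ?q) = pt k (c - 1)"
    by (simp_all add: vert_def)
  then show ?thesis using chain_side_in_sides[of ?q] q(3) by simp
qed

end

section \<open>The cells of a graph on the numbers below \<open>n\<close>, and their
  intersections\<close>

lemma sides_subset:
  assumes "s \<in> sides P"
  shows "s \<subseteq> P" "s \<noteq> {}"
proof -
  obtain vs i where "bounding_chain vs P" "i < length vs" "s = chain_side vs i"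
    using assms by (auto simp: sides_def)
  then show "s \<subseteq> P" "s \<noteq> {}"
    by (auto simp: bounding_chain_def chain_region_def chain_curve_def chain_side_def)
qed

context
  fixes n :: nat and E :: "nat \<Rightarrow> nat \<Rightarrow> bool"
begin

text \<open>Over \<open>x = k\<close> the partner of cell \<open>i\<close> is \<open>k - i\<close>;
  a long tooth ends at the lower border of the partner's strip. For \<open>k < i\<close> truncated
  subtraction gives \<open>0\<close>, which fails \<open>i < k - i\<close>.\<close>

definition tooth_hi :: "nat \<Rightarrow> nat \<Rightarrow> real" where
  "tooth_hi i k = (if i < k - i \<and> k - i < n \<and> E i (k - i) then 5 * real (k - i) - 1 else 5 * real i + 2)"

text \<open>A long tooth ends at the upper border of the partner's strip. Here the truncated value
  \<open>0\<close> could pass \<open>k - i < i\<close>, hence the explicit guard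
  \<open>i \<le> k\<close>.\<close>

definition tooth_lo :: "nat \<Rightarrow> nat \<Rightarrow> real" where
  "tooth_lo i k = (if i \<le> k \<and> k - i < i \<and> E (k - i) i then 5 * real (k - i) + 1 else 5 * real i - 2)"

text \<open>The width \<open>2 * n + 2\<close> puts every meeting line \<open>x = i + j\<close> with
  \<open>i \<noteq> j\<close> strictly between the ends of the strip.\<close>

definition cell :: "nat \<Rightarrow> point set" where
  "cell i = sawtooth.region (real i) (- (real i)\<^sup>2) (5 * real i) (2 * n + 2) (tooth_hi i) (tooth_lo i)"

lemma sawtooth_cell:
  assumes "i < n"
  shows "sawtooth (5 * real i) (5 * real n + 2) (2 * n + 2) (tooth_hi i) (tooth_lo i)"
proof
  fix k
  show "5 * real i + 1 < tooth_hi i k" "tooth_hi i k \<le> 5 * real i + (5 * real n + 2)"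
    "tooth_lo i k < 5 * real i - 1" "5 * real i - (5 * real n + 2) \<le> tooth_lo i k"
    using assms by (auto simp: tooth_hi_def tooth_lo_def)
qed simp

lemma polygon_cell: "i < n \<Longrightarrow> polygon (cell i)"
  unfolding cell_def by (rule sawtooth.polygon_region[OF sawtooth_cell])

lemma cell_coord:
  assumes "i < n" "p \<in> cell i"
  shows "p $ 2 = real i * p $ 1 - (real i)\<^sup>2"
proof -
  interpret sawtooth "real i" "- (real i)\<^sup>2" "5 * real i" "5 * real n + 2" "2 * n + 2" "tooth_hi i" "tooth_lo i"
    by (rule sawtooth_cell) fact
  show ?thesis using region_subset_plane assms(2) by (auto simp: plane_def cell_def)
qed

lemma cell_Int_coord:
  assumes "i < n" "j < n" "i \<noteq> j" "p \<in> cell i" "p \<in> cell j"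
  shows "p $ 1 = real (i + j)"
proof -
  have "(real i - real j) * p $ 1 = (real i - real j) * (real i + real j)"
    using cell_coord[of i p] cell_coord[of j p] assms by (simp add: algebra_simps power2_eq_square)
  then show ?thesis using assms(3) by simp
qed

text \<open>If the cells were equal, the whole cell would lie over \<open>x = i + j\<close>, but it
  has vertices at both ends of the strip.\<close>

lemma cell_neq:
  assumes "i < n" "j < n" "i \<noteq> j"
  shows "cell i \<noteq> cell j"
proof
  assume eq: "cell i = cell j"
  interpret sawtooth "real i" "- (real i)\<^sup>2" "5 * real i" "5 * real n + 2" "2 * n + 2" "tooth_hi i" "tooth_lo i"
    by (rule sawtooth_cell) fact
  have "vert 0 \<in> cell i" "vert (2 * (2 * n + 2)) \<in> cell i"
    unfolding cell_def by (rule vert_in_region; simp)+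
  then have "vert 0 $ 1 = vert (2 * (2 * n + 2)) $ 1"
    using cell_Int_coord[OF assms] eq by simp
  then show False unfolding vert_ends by simp
qed

lemma cell_Int:
  assumes ij: "i < j" "j < n"
  shows "E i j \<Longrightarrow> cell i \<inter> cell j \<in> sides (cell i) \<inter> sides (cell j)"
    and "\<not> E i j \<Longrightarrow> cell i \<inter> cell j = {}"
    and "rel_interior (cell i) \<inter> rel_interior (cell j) = {}"
proof -
  have n: "i < n" "j < n" "i \<noteq> j" using ij by auto
  interpret I: sawtooth "real i" "- (real i)\<^sup>2" "5 * real i" "5 * real n + 2" "2 * n + 2" "tooth_hi i" "tooth_lo i"
    by (rule sawtooth_cell) fact
  interpret J: sawtooth "real j" "- (real j)\<^sup>2" "5 * real j" "5 * real n + 2" "2 * n + 2" "tooth_hi j" "tooth_lo j"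
    by (rule sawtooth_cell) fact
  have cells: "cell i = I.region" "cell j = J.region" by (simp_all add: cell_def)
  have x: "p $ 1 = real (i + j)" if "p \<in> cell i" "p \<in> cell j" for p
    using cell_Int_coord[OF n that] .
  have z: "tooth_lo j (i + j) \<le> p $ 3" "p $ 3 \<le> tooth_hi i (i + j)"
    if "p \<in> cell i" "p \<in> cell j" for p
    using I.region_bounds(2)[of p "i + j"] J.region_bounds(1)[of p "i + j"] that x[OF that]
    by (auto simp: cells)
  have ends: "0 < i + j" "i + j < 2 * n + 2" using ij by auto
  {
    assume "E i j"
    then have hl: "tooth_hi i (i + j) = 5 * real j - 1" "tooth_lo j (i + j) = 5 * real i + 1"
      using ij by (auto simp: tooth_hi_def tooth_lo_def)
    let ?s = "closed_segment (I.pt (real (i + j)) (5 * real i + 1)) (I.pt (real (i + j)) (5 * real j - 1))"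
    \<comment> \<open>Over \<open>x = i + j\<close> both planes have second coordinate
      \<open>i * j\<close>.\<close>
    have pt: "I.pt (real (i + j)) t = J.pt (real (i + j)) t" for t
      unfolding vec_eq_iff forall_3 I.pt_nth J.pt_nth by (simp add: algebra_simps power2_eq_square)
    have sI: "?s \<in> sides (cell i)"
      using I.upper_tooth_side[OF ends] by (simp only: hl cells)
    have sJ: "?s \<in> sides (cell j)"
      using J.lower_tooth_side[OF ends] by (simp only: hl cells pt)
    have "cell i \<inter> cell j \<subseteq> ?s"
    proof
      fix p assume p: "p \<in> cell i \<inter> cell j"
      then have pij: "p \<in> cell i" "p \<in> cell j" by auto
      have "p $ 3 \<in> closed_segment (5 * real i + 1) (5 * real j - 1)"
        using z[OF pij] by (simp add: closed_segment_eq_real_ivl hl)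
      then obtain u where u: "0 \<le> u" "u \<le> 1" "p $ 3 = (1 - u) * (5 * real i + 1) + u * (5 * real j - 1)"
        by (auto simp: in_segment)
      have "p = (1 - u) *\<^sub>R I.pt (real (i + j)) (5 * real i + 1) + u *\<^sub>R I.pt (real (i + j)) (5 * real j - 1)"
        using x[OF pij] cell_coord[OF n(1) pij(1)] u(3)
        by (simp add: vec_eq_iff forall_3 algebra_simps)
      then show "p \<in> ?s" using u unfolding in_segment by blast
    qed
    then have "cell i \<inter> cell j = ?s"
      using sides_subset(1)[OF sI] sides_subset(1)[OF sJ] by blast
    then show "cell i \<inter> cell j \<in> sides (cell i) \<inter> sides (cell j)" using sI sJ by simp
  }
  {
    assume "\<not> E i j"
    then have hl: "tooth_hi i (i + j) = 5 * real i + 2" "tooth_lo j (i + j) = 5 * real j - 2"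
      using ij by (auto simp: tooth_hi_def tooth_lo_def)
    \<comment> \<open>The spacing \<open>5\<close> of the strips leaves a gap between two short
      teeth, even for neighbouring indices.\<close>
    have "5 * real i + 2 < 5 * real j - 2" using ij(1) by linarith
    then show "cell i \<inter> cell j = {}" using z unfolding hl by fastforce
  }
  show "rel_interior (cell i) \<inter> rel_interior (cell j) = {}"
  proof (rule equals0I)
    fix p assume p: "p \<in> rel_interior (cell i) \<inter> rel_interior (cell j)"
    then have "p \<in> cell i" "p \<in> cell j" using rel_interior_subset by blast+
    then have px: "p $ 1 = real (i + j)" by (rule x)
    \<comment> \<open>On the meeting line, the relative interior of the lower cell stays within its
      strip, while that of the upper cell stays strictly above its tip, which is no lower than the
      border of that strip.\<close>
    have "p $ 3 \<le> 5 * real i + 1"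
      using I.rel_interior_upper_bound[of p "i + j"] p px by (simp add: cells)
    moreover have "tooth_lo j (i + j) < p $ 3"
      using J.rel_interior_lower_bound[of p "i + j"] p px by (simp add: cells)
    moreover have "5 * real i + 1 \<le> tooth_lo j (i + j)"
      using ij by (auto simp: tooth_lo_def)
    ultimately show False by simp
  qed
qed

lemma cell_triple:
  assumes "i < n" "j < n" "k < n" "i \<noteq> j" "j \<noteq> k" "i \<noteq> k"
  shows "cell i \<inter> cell j \<inter> cell k = {}"
proof (rule equals0I)
  fix p assume "p \<in> cell i \<inter> cell j \<inter> cell k"
  then have "real (i + j) = real (i + k)"
    using cell_Int_coord[of i j p] cell_Int_coord[of i k p] assms by simp
  then show False using assms(5) by simp
qed

lemma cell_sides_disjoint:
  assumes "cell i \<inter> cell j = {}"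
  shows "sides (cell i) \<inter> sides (cell j) = {}"
  using assms sides_subset by blast

lemma polyhedral_surface_cells: "polyhedral_surface (cell ` {..<n})"
proof -
  have Int: "rel_interior (cell i) \<inter> rel_interior (cell j) = {}"
    "cell i \<inter> cell j \<noteq> {} \<Longrightarrow> cell i \<inter> cell j \<in> sides (cell i) \<inter> sides (cell j)"
    if "i < n" "j < n" "i \<noteq> j" for i j
    using cell_Int[of i j] cell_Int[of j i] that
    by (metis Int_commute linorder_neqE_nat)+
  have triple: "cell i \<inter> cell j \<inter> cell k = {}"
    if "i < n" "j < n" "k < n" "cell i \<noteq> cell j" "cell j \<noteq> cell k" "cell i \<noteq> cell k" for i j k
    using cell_triple[of i j k] that by blast
  show ?thesis
    unfolding polyhedral_surface_def
  proof (intro conjI)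
    show "\<forall>P\<in>cell ` {..<n}. \<forall>Q\<in>cell ` {..<n}. \<forall>R\<in>cell ` {..<n}. P \<noteq> Q \<longrightarrow> Q \<noteq> R \<longrightarrow> P \<noteq> R \<longrightarrow>
        P \<inter> Q \<inter> R \<noteq> {} \<longrightarrow> (\<exists>v\<in>corners P \<inter> corners Q \<inter> corners R. P \<inter> Q \<inter> R = {v})"
      using triple by blast
    show "\<forall>P\<in>cell ` {..<n}. \<forall>Q\<in>cell ` {..<n}. P \<noteq> Q \<longrightarrow> rel_interior P \<inter> rel_interior Q = {}"
      using Int(1) by blast
    show "\<forall>P\<in>cell ` {..<n}. \<forall>Q\<in>cell ` {..<n}. P \<noteq> Q \<longrightarrow> P \<inter> Q \<noteq> {} \<longrightarrow>
        (\<exists>v\<in>corners P \<inter> corners Q. P \<inter> Q = {v}) \<or> P \<inter> Q \<in> sides P \<inter> sides Q"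
      using Int(2) by blast
  qed (auto simp: polygon_cell)
qed

lemma share_side_iff:
  assumes "i < n" "j < n" "i \<noteq> j" and sym: "E i j \<longleftrightarrow> E j i"
  shows "sides (cell i) \<inter> sides (cell j) \<noteq> {} \<longleftrightarrow> E i j"
proof -
  have "sides (cell i) \<inter> sides (cell j) \<noteq> {} \<longleftrightarrow> E i j" if "i < j" "j < n" for i j
    using cell_Int(1,2)[OF that] cell_sides_disjoint by blast
  from this[of i j] this[of j i] show ?thesis
    using assms by (metis Int_commute linorder_neqE_nat)
qed

end

section \<open>Transfer to an arbitrary graph\<close>

lemma digraph_iso_pair_digraphI:
  assumes wf: "pair_wf_digraph G" and inj: "inj_on f (pverts G)"
    and verts: "pverts H = f ` pverts G" and arcs: "parcs H = map_prod f f ` parcs G"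
  shows "digraph_iso (with_proj H) (with_proj G)"
proof -
  interpret pair_wf_digraph G by fact
  \<comment> \<open>Arcs are pairs, so tail and head of a relabelled arc are again its components,
    and relabelling \<open>G\<close> yields exactly \<open>H\<close>.\<close>
  let ?h = "\<lparr>iso_verts = f, iso_arcs = map_prod f f, iso_head = snd, iso_tail = fst\<rparr>"
  have "inj_on (map_prod f f) (parcs G)"
    using map_prod_inj_on[OF inj inj] by (rule inj_on_subset) (auto simp: in_arcsD1 in_arcsD2)
  then have "pre_digraph.digraph_isomorphism (with_proj G) ?h"
    using inj wf by (simp add: pre_digraph.digraph_isomorphism_def wf_digraph_wp_iff)
  moreover have "with_proj H = app_iso ?h (with_proj G)"
    by (simp add: app_iso_def with_proj_def verts arcs)
  ultimately have "digraph_iso (with_proj G) (with_proj H)"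
    unfolding digraph_iso_def by blast
  then show ?thesis
    using wf wf_digraph_wp_iff digraph_iso_swap by blast
qed

theorem proposition1:
  fixes G :: "'a pair_pre_digraph"
  assumes "pair_graph G"
  shows "\<exists>\<S>. polyhedral_surface \<S> \<and>
           digraph_iso (with_proj (adjacency_graph \<S>)) (with_proj G)"
proof -
  interpret pair_graph G by fact
  define n where "n = card (pverts G)"
  obtain g where g: "bij_betw g (pverts G) {..<n}"
    using ex_bij_betw_finite_nat[OF pair_finite_verts] by (auto simp: n_def atLeast0LessThan)
  \<comment> \<open>The edge relation carried over to the numbers below \<open>n\<close> along the
    enumeration \<open>g\<close>.\<close>
  define E where "E i j = (\<exists>u v. (u, v) \<in> parcs G \<and> i = g u \<and> j = g v)" for i j
  define f where "f = cell n E \<circ> g"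
  define \<S> where "\<S> = cell n E ` {..<n}"
  have g_lt: "g u < n" if "u \<in> pverts G" for u
    using g that by (auto simp: bij_betw_def)
  have g_eq: "g u = g v \<longleftrightarrow> u = v" if "u \<in> pverts G" "v \<in> pverts G" for u v
    using g that by (auto simp: bij_betw_def dest: inj_onD)
  have sym: "(v, u) \<in> parcs G" if "(u, v) \<in> parcs G" for u v
    using pair_sym_arcs that by (auto simp: symmetric_def sym_def)
  have E_sym: "E i j \<longleftrightarrow> E j i" for i j
    using sym by (auto simp: E_def)
  have E_g: "E (g u) (g v) \<longleftrightarrow> (u, v) \<in> parcs G" if "u \<in> pverts G" "v \<in> pverts G" for u v
    using that g_eq unfolding E_def by (metis in_arcsD1 in_arcsD2)
  have f_eq: "f u = f v \<longleftrightarrow> u = v" if "u \<in> pverts G" "v \<in> pverts G" for u v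
    using cell_neq[of "g u" n "g v" E] that g_lt g_eq by (auto simp: f_def)
  have verts: "\<S> = f ` pverts G"
    using g unfolding bij_betw_def \<S>_def f_def image_comp[symmetric] by simp
  have adj: "f u \<noteq> f v \<and> sides (f u) \<inter> sides (f v) \<noteq> {} \<longleftrightarrow> (u, v) \<in> parcs G"
    if "u \<in> pverts G" "v \<in> pverts G" for u v
  proof (cases "u = v")
    case True
    then show ?thesis using no_loops' by blast
  next
    case False
    then show ?thesis
      using share_side_iff[of "g u" n "g v" E] that E_sym E_g f_eq g_eq g_lt by (simp add: f_def)
  qed
  have "{(P, Q). P \<in> \<S> \<and> Q \<in> \<S> \<and> P \<noteq> Q \<and> sides P \<inter> sides Q \<noteq> {}} = map_prod f f ` parcs G"
  proof (intro set_eqI iffI)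
    fix e assume "e \<in> {(P, Q). P \<in> \<S> \<and> Q \<in> \<S> \<and> P \<noteq> Q \<and> sides P \<inter> sides Q \<noteq> {}}"
    then obtain u v where "e = (f u, f v)" "u \<in> pverts G" "v \<in> pverts G"
      "f u \<noteq> f v \<and> sides (f u) \<inter> sides (f v) \<noteq> {}"
      unfolding verts by auto
    then show "e \<in> map_prod f f ` parcs G" using adj[of u v] by force
  next
    fix e assume "e \<in> map_prod f f ` parcs G"
    then obtain u v where e: "e = (f u, f v)" "(u, v) \<in> parcs G" by auto
    then have "u \<in> pverts G" "v \<in> pverts G" by (auto dest: in_arcsD1 in_arcsD2)
    then show "e \<in> {(P, Q). P \<in> \<S> \<and> Q \<in> \<S> \<and> P \<noteq> Q \<and> sides P \<inter> sides Q \<noteq> {}}"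
      using adj[of u v] e unfolding verts by auto
  qed
  then have "digraph_iso (with_proj (adjacency_graph \<S>)) (with_proj G)"
    using verts f_eq by (intro digraph_iso_pair_digraphI pair_wf_digraph)
      (auto simp: adjacency_graph_def inj_on_def)
  moreover have "polyhedral_surface \<S>"
    unfolding \<S>_def by (rule polyhedral_surface_cells)
  ultimately show ?thesis by blast
qed

end
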